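(* Let $m,n\ge 2$ be relatively prime integers, $m'$ an integer that is a multiplicative inverse of $m$ modulo $n$, and $n'$ an integer that is a multiplicative inverse of $n$ modulo $m$. Define the automaton $D_{m,n}=(D,X,\rho,\tau)$, where $D=\{d_0,\dots,d_{m-1}\}$, $X=\{x_0,\dots,x_{n-1}\}$ and $$\rho(d_i,x_j)=x_{m'(j-i)\boxdot n},\qquad \tau(d_i,x_j)=d_{n'(i-j)\boxdot m}.$$ Then: (a) the definition of the automaton $D_{m,n}$ does not depend on the choice of $m'$ and $n'$; (b) $D_{m,n}$ is the inverse of the automaton $S_{m,n}$ (under the identification of the state $d_i$ with $\overline{s_i}$ and of the letter $x_j$ with $x_j$); (c) the dual of the automaton $D_{m,n}$ is $D_{n,m}$ (under the identification of the state $x_j$ of the dual with the state $d_j$ of $D_{n,m}$, and of the letter $d_i$ of the dual with the letter $x_i$ of $D_{n,m}$); (d) the automaton $D_{m,n}$ is bi-invertible; (e) the group $G(D_{m,n})$ is isomorphic to the Baumslag–Solitar group $BS(1,m)=\langle a,t\mid tat^{-1}=a^m\rangle$.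
   Context: For an integer $a$ and a positive integer $b$, $a\boxdot b\in\{0,\dots,b-1\}$ and $a\div b$ denote the remainder and the quotient of the division of $a$ by $b$, so $a=b(a\div b)+(a\boxdot b)$. An automaton is a quadruple $A=(Q,X,\rho,\tau)$ with $Q$ a finite set (states), $X$ a finite set (alphabet), and functions $\rho:Q\times X\to X$ (rewriting) and $\tau:Q\times X\to Q$ (transition). It is invertible if for every $q\in Q$ the map $\rho_q:X\to X$, $x\mapsto\rho(q,x)$, is a permutation. Each state $q$ of an invertible automaton defines an automorphism, also denoted $q$, of the rooted tree $X^*$ of finite words over $X$, recursively by $q(\emptyset)=\emptyset$ and $q(xw)=\rho(q,x)\,q_x(w)$, where $q_x=\tau(q,x)$. The group $G(A)$ of an invertible automaton is the subgroup of $\mathrm{Aut}(X^* )$ generated by the automorphisms defined by all states. The inverse of an invertible automaton $A=(Q,X,\rho,\tau)$ is $\overline{A}=(\overline{Q},X,\overline\rho,\overline\tau)$, where $\overline Q=\{\overline q\mid q\in Q\}$ is a copy of $Q$, $\overline\rho(\overline q,x)=\rho_q^{-1}(x)$ and $\overline\tau(\overline q,x)=\overline{\tau(q,\rho_q^{-1}(x))}$. The dual of an automaton $A=(Q,X,\rho,\tau)$ is $A'=(X,Q,\rho',\tau')$ with $\rho'(x,q)=\tau(q,x)$ and $\tau'(x,q)=\rho(q,x)$. An automaton is bi-invertible if both it and its dual are invertible. For relatively prime positive integers $m,n$, $S_{m,n}=(S,X,\rho,\tau)$ is the invertible automaton with $S=\{s_0,\dots,s_{m-1}\}$, $X=\{x_0,\dots,x_{n-1}\}$,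 $\rho(s_i,x_j)=x_{(mj+i)\boxdot n}$ and $\tau(s_i,x_j)=s_{(mj+i)\div n}$. *)

theory Defs
  imports
    "HOL-Algebra.Bij"
    "HOL-Algebra.Elementary_Groups"
    "HOL-Number_Theory.Cong"
begin

section \<open>Automata\<close>

record ('q, 'x) automaton =
  states :: "'q set"
  alphabet :: "'x set"
  rewriting :: "'q \<times> 'x \<Rightarrow> 'x"
  transition :: "'q \<times> 'x \<Rightarrow> 'q"

text \<open>
  Both functions are extensional on \<open>states A \<times> alphabet A\<close>, so that equality of records
  is equality of automata.
\<close>

definition is_automaton :: "('q, 'x) automaton \<Rightarrow> bool" where
  "is_automaton A \<longleftrightarrow>
     finite (states A) \<and> finite (alphabet A) \<and>
     rewriting A \<in> states A \<times> alphabet A \<rightarrow>\<^sub>E alphabet A \<and>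
     transition A \<in> states A \<times> alphabet A \<rightarrow>\<^sub>E states A"

definition invertible_automaton :: "('q, 'x) automaton \<Rightarrow> bool" where
  "invertible_automaton A \<longleftrightarrow>
     is_automaton A \<and>
     (\<forall>q\<in>states A. bij_betw (\<lambda>x. rewriting A (q, x)) (alphabet A) (alphabet A))"

datatype 'q inverse_state = Bar 'q

primrec unbar :: "'q inverse_state \<Rightarrow> 'q" where
  "unbar (Bar q) = q"

definition inverse_automaton ::
  "('q, 'x) automaton \<Rightarrow> ('q inverse_state, 'x) automaton" where
  "inverse_automaton A =
    (let \<rho>inv = (\<lambda>q. inv_into (alphabet A) (\<lambda>x. rewriting A (q, x))) in
     \<lparr>states = Bar ` states A,
      alphabet = alphabet A,
      rewriting = (\<lambda>(p, x) \<in> (Bar ` states A) \<times> alphabet A. \<rho>inv (unbar p) x),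
      transition = (\<lambda>(p, x) \<in> (Bar ` states A) \<times> alphabet A.
        Bar (transition A (unbar p, \<rho>inv (unbar p) x)))\<rparr>)"

definition dual_automaton :: "('q, 'x) automaton \<Rightarrow> ('x, 'q) automaton" where
  "dual_automaton A =
     \<lparr>states = alphabet A,
      alphabet = states A,
      rewriting = (\<lambda>(x, q) \<in> alphabet A \<times> states A. transition A (q, x)),
      transition = (\<lambda>(x, q) \<in> alphabet A \<times> states A. rewriting A (q, x))\<rparr>"

definition bi_invertible :: "('q, 'x) automaton \<Rightarrow> bool" where
  "bi_invertible A \<longleftrightarrow> invertible_automaton A \<and> invertible_automaton (dual_automaton A)"

text \<open>\<open>A\<close> becomes \<open>B\<close> when states are identified via \<open>\<phi>\<close> and letters via \<open>\<psi>\<close>.\<close>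

definition automaton_iso ::
  "('q \<Rightarrow> 'r) \<Rightarrow> ('x \<Rightarrow> 'y) \<Rightarrow> ('q, 'x) automaton \<Rightarrow> ('r, 'y) automaton \<Rightarrow> bool" where
  "automaton_iso \<phi> \<psi> A B \<longleftrightarrow>
     bij_betw \<phi> (states A) (states B) \<and> bij_betw \<psi> (alphabet A) (alphabet B) \<and>
     (\<forall>q\<in>states A. \<forall>x\<in>alphabet A.
        rewriting B (\<phi> q, \<psi> x) = \<psi> (rewriting A (q, x)) \<and>
        transition B (\<phi> q, \<psi> x) = \<phi> (transition A (q, x)))"


section \<open>The group of an automaton\<close>

text \<open>
  Vertices of the rooted tree are the words in \<open>lists X\<close>, the root is \<open>[]\<close>, and the children
  of \<open>u\<close> are the words \<open>u @ [x]\<close>.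
\<close>

definition tree_automorphisms :: "'x set \<Rightarrow> ('x list \<Rightarrow> 'x list) set" where
  "tree_automorphisms X =
     {f \<in> Bij (lists X). f [] = [] \<and>
        (\<forall>u\<in>lists X. \<forall>v\<in>lists X. (\<exists>x. v = u @ [x]) \<longleftrightarrow> (\<exists>y. f v = f u @ [y]))}"

definition tree_automorphism_group :: "'x set \<Rightarrow> ('x list \<Rightarrow> 'x list) monoid" where
  "tree_automorphism_group X = (BijGroup (lists X)) \<lparr>carrier := tree_automorphisms X\<rparr>"

primrec run :: "('q, 'x) automaton \<Rightarrow> 'q \<Rightarrow> 'x list \<Rightarrow> 'x list" where
  "run A q [] = []"
| "run A q (x # w) = rewriting A (q, x) # run A (transition A (q, x)) w"

definition state_action :: "('q, 'x) automaton \<Rightarrow> 'q \<Rightarrow> 'x list \<Rightarrow> 'x list" where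
  "state_action A q = restrict (run A q) (lists (alphabet A))"

definition automaton_group :: "('q, 'x) automaton \<Rightarrow> ('x list \<Rightarrow> 'x list) monoid" where
  "automaton_group A =
     subgroup_generated (tree_automorphism_group (alphabet A)) (state_action A ` states A)"

text \<open>
  The constant \<open>subgroup_generated\<close> discards generators outside the carrier; the lemma
  \<open>state_action_in_carrier\<close> shows that nothing is discarded for an invertible automaton.
\<close>

lemma length_run [simp]: "length (run A q w) = length w"
  by (induction w arbitrary: q) auto

lemma run_append_single: "\<exists>y. run A q (w @ [x]) = run A q w @ [y]"
  by (induction w arbitrary: q) auto

lemma run_take: "run A q (take k w) = take k (run A q w)"
proof (induction w arbitrary: q k)
  case (Cons x w)
  then show ?case by (cases k) auto
qed simp

lemma
  assumes "invertible_automaton A"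
  shows invertible_rewriting_bij:
      "q \<in> states A \<Longrightarrow> bij_betw (\<lambda>x. rewriting A (q, x)) (alphabet A) (alphabet A)"
    and invertible_rewriting_closed:
      "q \<in> states A \<Longrightarrow> x \<in> alphabet A \<Longrightarrow> rewriting A (q, x) \<in> alphabet A"
    and invertible_transition_closed:
      "q \<in> states A \<Longrightarrow> x \<in> alphabet A \<Longrightarrow> transition A (q, x) \<in> states A"
  using assms by (auto simp: invertible_automaton_def is_automaton_def)

lemma run_in_lists:
  assumes "invertible_automaton A" "q \<in> states A" "w \<in> lists (alphabet A)"
  shows "run A q w \<in> lists (alphabet A)"
  using assms(3,2)
  by (induction w arbitrary: q)
    (auto simp: invertible_rewriting_closed[OF assms(1)] invertible_transition_closed[OF assms(1)])

lemma run_inj: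
  assumes inv: "invertible_automaton A" and "q \<in> states A"
    and "v \<in> lists (alphabet A)" "w \<in> lists (alphabet A)" "run A q v = run A q w"
  shows "v = w"
  using assms(2-)
proof (induction v arbitrary: q w)
  case Nil
  then show ?case by (metis length_0_conv length_run)
next
  case (Cons x v)
  then obtain y u where w: "w = y # u" by (cases w) auto
  have "x = y"
    using Cons.prems invertible_rewriting_bij[OF inv] unfolding w bij_betw_def
    by (auto dest: inj_onD)
  then show ?case
    using Cons invertible_transition_closed[OF inv] unfolding w by auto
qed

lemma run_surj:
  assumes inv: "invertible_automaton A" and "q \<in> states A" "w \<in> lists (alphabet A)"
  shows "\<exists>v \<in> lists (alphabet A). run A q v = w"
  using assms(2-)
proof (induction w arbitrary: q)
  case Nil
  show ?case by (rule bexI[of _ "[]"]) auto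
next
  case (Cons y w)
  from Cons.prems have "y \<in> (\<lambda>x. rewriting A (q, x)) ` alphabet A"
    using invertible_rewriting_bij[OF inv, of q] by (simp add: bij_betw_def)
  then obtain x where x: "x \<in> alphabet A" "rewriting A (q, x) = y" by auto
  with Cons obtain v where "v \<in> lists (alphabet A)" "run A (transition A (q, x)) v = w"
    using invertible_transition_closed[OF inv, of q x] by auto
  with x show ?case by (intro bexI[of _ "x # v"]) auto
qed

lemma state_action_in_carrier:
  assumes inv: "invertible_automaton A" and q: "q \<in> states A"
  shows "state_action A q \<in> carrier (tree_automorphism_group (alphabet A))"
proof -
  let ?L = "lists (alphabet A)"
  have "bij_betw (run A q) ?L ?L"
    using run_in_lists[OF inv q] run_inj[OF inv q] run_surj[OF inv q]
    by (fastforce simp: bij_betw_def inj_on_def)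
  then have "state_action A q \<in> Bij ?L"
    by (simp add: Bij_def state_action_def bij_betw_restrict_eq)
  moreover have "(\<exists>x. v = u @ [x]) \<longleftrightarrow> (\<exists>y. run A q v = run A q u @ [y])"
    if uv: "u \<in> ?L" "v \<in> ?L" for u v
  proof
    assume "\<exists>x. v = u @ [x]"
    then show "\<exists>y. run A q v = run A q u @ [y]" using run_append_single by metis
  next
    assume "\<exists>y. run A q v = run A q u @ [y]"
    then obtain y where y: "run A q v = run A q u @ [y]" ..
    then have len: "length v = Suc (length u)"
      by (metis length_append_singleton length_run)
    have "run A q (take (length u) v) = run A q u"
      by (simp add: run_take y)
    moreover have "take (length u) v \<in> ?L"
      using uv(2) by (auto dest: in_set_takeD)
    ultimately have "take (length u) v = u"
      using run_inj[OF inv q _ uv(1)] by blast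
    then show "\<exists>x. v = u @ [x]"
      using len by (metis append_take_drop_id length_drop length_Suc_conv diff_Suc_Suc
          Suc_diff_le le_refl diff_self_eq_0 length_0_conv)
  qed
  ultimately show ?thesis
    by (auto simp: tree_automorphism_group_def tree_automorphisms_def state_action_def)
qed


section \<open>Groups given by generators and relations\<close>

text \<open>
  All elements of the type \<open>'g\<close> are generators; a letter \<open>(g, True)\<close> stands for \<open>g\<close> and
  \<open>(g, False)\<close> for the inverse of \<open>g\<close>. A pair \<open>(u, v)\<close> in \<open>R\<close> is the relation \<open>u = v\<close>.
\<close>

type_synonym 'g gword = "('g \<times> bool) list"

inductive presentation_eq :: "('g gword \<times> 'g gword) set \<Rightarrow> 'g gword \<Rightarrow> 'g gword \<Rightarrow> bool"
  for R where
  relation: "(u, v) \<in> R \<Longrightarrow> presentation_eq R u v"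
| cancel: "presentation_eq R [(g, b), (g, \<not> b)] []"
| refl: "presentation_eq R u u"
| sym: "presentation_eq R u v \<Longrightarrow> presentation_eq R v u"
| trans: "presentation_eq R u v \<Longrightarrow> presentation_eq R v w \<Longrightarrow> presentation_eq R u w"
| append: "presentation_eq R u u' \<Longrightarrow> presentation_eq R v v' \<Longrightarrow> presentation_eq R (u @ v) (u' @ v')"

definition presented_group :: "('g gword \<times> 'g gword) set \<Rightarrow> 'g gword set monoid" where
  "presented_group R =
     \<lparr>carrier = UNIV // {(u, v). presentation_eq R u v},
      monoid.mult = (\<lambda>U V. {w. \<exists>u\<in>U. \<exists>v\<in>V. presentation_eq R (u @ v) w}),
      one = {w. presentation_eq R [] w}\<rparr>"

lemma carrier_presented_groupD:
  "U \<in> carrier (presented_group R) \<Longrightarrow> \<exists>u. U = {w. presentation_eq R u w}"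
  by (auto simp: presented_group_def quotient_def)

lemma class_in_carrier_presented_group:
  "{w. presentation_eq R u w} \<in> carrier (presented_group R)"
  by (auto simp: presented_group_def quotient_def)

lemma mult_presented_group:
  "{w. presentation_eq R u w} \<otimes>\<^bsub>presented_group R\<^esub> {w. presentation_eq R v w}
     = {w. presentation_eq R (u @ v) w}"
  unfolding presented_group_def
  by (auto intro: presentation_eq.intros)

lemma presentation_eq_inverse:
  "presentation_eq R (rev (map (\<lambda>(g, b). (g, \<not> b)) u) @ u) []"
proof (induction u)
  case Nil
  show ?case by (simp add: presentation_eq.refl)
next
  case (Cons a u)
  obtain g b where a: "a = (g, b)" by (cases a)
  let ?r = "rev (map (\<lambda>(g, b). (g, \<not> b)) u)"
  have "presentation_eq R [(g, \<not> b), (g, b)] []"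
    using presentation_eq.cancel[of R g "\<not> b"] by simp
  then have "presentation_eq R (?r @ ([(g, \<not> b), (g, b)] @ u)) (?r @ ([] @ u))"
    by (intro presentation_eq.append presentation_eq.refl)
  with Cons show ?case unfolding a
    by (auto intro: presentation_eq.trans)
qed

lemma group_presented_group: "group (presented_group R)"
proof (rule groupI)
  have one: "\<one>\<^bsub>presented_group R\<^esub> = {w. presentation_eq R [] w}"
    by (simp add: presented_group_def)
  show "\<one>\<^bsub>presented_group R\<^esub> \<in> carrier (presented_group R)"
    unfolding one by (rule class_in_carrier_presented_group)
  fix x assume "x \<in> carrier (presented_group R)"
  then obtain u where u: "x = {w. presentation_eq R u w}"
    using carrier_presented_groupD by blast
  show "\<one>\<^bsub>presented_group R\<^esub> \<otimes>\<^bsub>presented_group R\<^esub> x = x"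
    unfolding one u mult_presented_group by simp
  let ?u' = "rev (map (\<lambda>(g, b). (g, \<not> b)) u)"
  have "{w. presentation_eq R (?u' @ u) w} = {w. presentation_eq R [] w}"
    using presentation_eq_inverse[of R u]
    by (meson presentation_eq.sym presentation_eq.trans)
  then show "\<exists>y\<in>carrier (presented_group R). y \<otimes>\<^bsub>presented_group R\<^esub> x = \<one>\<^bsub>presented_group R\<^esub>"
    unfolding one u using mult_presented_group[of R ?u' u] class_in_carrier_presented_group by blast
qed (auto dest!: carrier_presented_groupD simp: mult_presented_group class_in_carrier_presented_group)

datatype bs_generator = a_gen | t_gen

text \<open>\<open>BS(k, m) = \<langle>a, t | t a\<^sup>k t\<^sup>-\<^sup>1 = a\<^sup>m\<rangle>\<close>\<close>

definition baumslag_solitar :: "nat \<Rightarrow> nat \<Rightarrow> bs_generator gword set monoid" where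
  "baumslag_solitar k m =
     presented_group
       {([(t_gen, True)] @ replicate k (a_gen, True) @ [(t_gen, False)],
         replicate m (a_gen, True))}"


section \<open>The automata \<open>S\<close> and \<open>D\<close>\<close>

text \<open>The states \<open>s\<^sub>i\<close>, \<open>d\<^sub>i\<close> and the letters \<open>x\<^sub>j\<close> are represented by their indices.\<close>

definition S_automaton :: "nat \<Rightarrow> nat \<Rightarrow> (nat, nat) automaton" where
  "S_automaton m n =
     \<lparr>states = {..<m}, alphabet = {..<n},
      rewriting = (\<lambda>(i, j) \<in> {..<m} \<times> {..<n}. (m * j + i) mod n),
      transition = (\<lambda>(i, j) \<in> {..<m} \<times> {..<n}. (m * j + i) div n)\<rparr>"

text \<open>
  \<open>m'\<close> is to be an inverse of \<open>m\<close> modulo \<open>n\<close>, and \<open>n'\<close> an inverse of \<open>n\<close> modulo \<open>m\<close>.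
  Swapping \<open>m\<close> and \<open>n\<close> therefore also swaps the roles of \<open>m'\<close> and \<open>n'\<close>.
\<close>

definition D_automaton :: "nat \<Rightarrow> nat \<Rightarrow> int \<Rightarrow> int \<Rightarrow> (nat, nat) automaton" where
  "D_automaton m n m' n' =
     \<lparr>states = {..<m}, alphabet = {..<n},
      rewriting = (\<lambda>(i, j) \<in> {..<m} \<times> {..<n}. nat ((m' * (int j - int i)) mod int n)),
      transition = (\<lambda>(i, j) \<in> {..<m} \<times> {..<n}. nat ((n' * (int i - int j)) mod int m))\<rparr>"

lemma invertible_S_automaton:
  assumes "m > 0" "n > 0" "coprime m n"
  shows "invertible_automaton (S_automaton m n)"
proof -
  have "(m * j + i) div n < m" if "i < m" "j < n" for i j
  proof -
    have "m * j + i < m * Suc j" using that by simp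
    also have "\<dots> \<le> m * n" using that by (intro mult_le_mono2) simp
    finally show ?thesis using assms by (simp add: less_mult_imp_div_less)
  qed
  then have "is_automaton (S_automaton m n)"
    using assms by (auto simp: is_automaton_def S_automaton_def)
  moreover have "bij_betw (\<lambda>j. (m * j + i) mod n) {..<n} {..<n}" for i
  proof -
    have "inj_on (\<lambda>j. (m * j + i) mod n) {..<n}"
    proof (rule inj_onI)
      fix j k assume jk: "j \<in> {..<n}" "k \<in> {..<n}" "(m * j + i) mod n = (m * k + i) mod n"
      then have "[m * j = m * k] (mod n)"
        by (simp add: cong_def[symmetric] cong_add_rcancel_nat)
      then have "[j = k] (mod n)"
        using assms(3) by (simp add: cong_mult_lcancel_nat)
      with jk show "j = k" by (simp add: cong_def)
    qed
    then show ?thesis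
      using assms by (intro bij_betw_imageI endo_inj_surj) auto
  qed
  then have "bij_betw (\<lambda>j. rewriting (S_automaton m n) (i, j)) {..<n} {..<n}" if "i < m" for i
    using that by (subst bij_betw_cong[where g = "\<lambda>j. (m * j + i) mod n"])
      (auto simp: S_automaton_def)
  ultimately show ?thesis
    by (simp add: invertible_automaton_def) (simp add: S_automaton_def)
qed

end

theory Submission
  imports Defs
begin

text \<open>
  A word over \<open>{..<n}\<close> of length \<open>l\<close> is read as an integer modulo \<open>n ^ l\<close>, least significant digit
  first. Then \<open>s\<^sub>i\<close> acts as \<open>z \<mapsto> m z + i\<close>, and \<open>d\<^sub>i\<close> as its inverse. Hence the group is generated
  by \<open>t = s\<^sub>0\<close> and \<open>a = s\<^sub>1 s\<^sub>0\<^sup>-\<^sup>1\<close>, which is \<open>z \<mapsto> z + 1\<close>; since \<open>s\<^sub>i = a\<^sup>i t\<close>, no further generators are needed.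
  Every element of \<open>BS(1, m)\<close> has the form \<open>t\<^sup>-\<^sup>p a\<^sup>b t\<^sup>q\<close>. If it acts trivially, then
  \<open>m\<^sup>q z + b = m\<^sup>p z\<close> modulo all powers of \<open>n\<close>, so \<open>b = 0\<close> and \<open>p = q\<close>.
\<close>

section \<open>Presented groups\<close>

text \<open>This is the homomorphism from the free group on the generators, written on words that
  need not be reduced.\<close>

primrec word_eval :: "('a, 'b) monoid_scheme \<Rightarrow> ('g \<Rightarrow> 'a) \<Rightarrow> 'g gword \<Rightarrow> 'a" where
  "word_eval G f [] = \<one>\<^bsub>G\<^esub>"
| "word_eval G f (x # u) =
     (if snd x then f (fst x) else inv\<^bsub>G\<^esub> f (fst x)) \<otimes>\<^bsub>G\<^esub> word_eval G f u"

context group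
begin

lemma word_eval_closed [simp]:
  assumes "range f \<subseteq> carrier G"
  shows "word_eval G f u \<in> carrier G"
  using assms by (induction u) auto

lemma word_eval_append:
  assumes "range f \<subseteq> carrier G"
  shows "word_eval G f (u @ v) = word_eval G f u \<otimes> word_eval G f v"
proof (induction u)
  case (Cons x u)
  have "f (fst x) \<in> carrier G" using assms by auto
  then show ?case using Cons assms by (simp add: m_assoc)
qed (use assms in simp)

lemma word_eval_replicate:
  assumes "range f \<subseteq> carrier G"
  shows "word_eval G f (replicate k (g, True)) = f g [^] k"
proof (induction k)
  case (Suc k)
  have "f g \<in> carrier G" using assms by auto
  then show ?case using Suc by (simp add: nat_pow_Suc2[symmetric] del: nat_pow_Suc)
qed simp

text \<open>Each rule that generates \<open>presentation_eq\<close> is sound in a group once the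
  relations in \<open>R\<close> hold there, so evaluation descends to classes of words.\<close>

lemma word_eval_presentation_eq:
  assumes f: "range f \<subseteq> carrier G"
    and R: "\<And>u v. (u, v) \<in> R \<Longrightarrow> word_eval G f u = word_eval G f v"
    and "presentation_eq R u v"
  shows "word_eval G f u = word_eval G f v"
  using assms(3)
proof induction
  case (cancel g b)
  have "f g \<in> carrier G" using f by auto
  then show ?case by simp
qed (simp_all add: R word_eval_append[OF f])

text \<open>A derivation in \<open>generate\<close> is turned into a word, products becoming
  concatenations. This later identifies the image of a presented group.\<close>

lemma generate_range_eq_word_eval:
  assumes f: "range f \<subseteq> carrier G"
  shows "generate G (range f) = range (word_eval G f)"
proof
  have gen: "f g \<in> carrier G" for g using f by auto
  show "generate G (range f) \<subseteq> range (word_eval G f)"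
  proof
    fix x assume "x \<in> generate G (range f)"
    then show "x \<in> range (word_eval G f)"
    proof induction
      case one
      show ?case by (rule range_eqI[of _ _ "[]"]) simp
    next
      case (incl x)
      then obtain g where "x = f g" by blast
      then show ?case using gen by (intro range_eqI[of _ _ "[(g, True)]"]) simp
    next
      case (inv x)
      then obtain g where "x = f g" by blast
      then show ?case using gen by (intro range_eqI[of _ _ "[(g, False)]"]) simp
    next
      case (eng x y)
      then obtain u v where "x = word_eval G f u" "y = word_eval G f v" by blast
      then show ?case by (intro range_eqI[of _ _ "u @ v"]) (simp add: word_eval_append[OF f])
    qed
  qed
  have "word_eval G f u \<in> generate G (range f)" for u
    by (induction u) (auto intro: generate.intros)
  then show "range (word_eval G f) \<subseteq> generate G (range f)" by blast
qed

end

definition presented_class :: "('g gword \<times> 'g gword) set \<Rightarrow> 'g gword \<Rightarrow> 'g gword set" where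
  "presented_class R u = {w. presentation_eq R u w}"

lemma presented_class_eq_iff:
  "presented_class R u = presented_class R v \<longleftrightarrow> presentation_eq R u v"
  unfolding presented_class_def
  by (metis (mono_tags, lifting) Collect_cong mem_Collect_eq presentation_eq.refl
      presentation_eq.sym presentation_eq.trans)

lemma one_presented_group: "\<one>\<^bsub>presented_group R\<^esub> = presented_class R []"
  by (simp add: presented_group_def presented_class_def)

lemma presented_class_mult:
  "presented_class R u \<otimes>\<^bsub>presented_group R\<^esub> presented_class R v = presented_class R (u @ v)"
  by (simp add: presented_class_def mult_presented_group)

lemma carrier_presented_group: "carrier (presented_group R) = range (presented_class R)"
  unfolding presented_class_def
  using carrier_presented_groupD class_in_carrier_presented_group by fast

text \<open>Every class is a value of \<open>word_eval\<close> inside the presented group itself, so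
  facts proved by evaluation in an arbitrary group apply to classes.\<close>

lemma word_eval_presented_group:
  "word_eval (presented_group R) (\<lambda>g. presented_class R [(g, True)]) u = presented_class R u"
proof (induction u)
  case Nil
  show ?case by (simp add: one_presented_group)
next
  case (Cons x u)
  obtain g b where x: "x = (g, b)" by (cases x)
  interpret group "presented_group R" by (rule group_presented_group)
  have "presentation_eq R ([(g, False)] @ [(g, True)]) []"
    using presentation_eq.cancel[of R g False] by simp
  then have "inv\<^bsub>presented_group R\<^esub> presented_class R [(g, True)] = presented_class R [(g, False)]"
    by (intro inv_equality)
      (auto simp: presented_class_mult one_presented_group presented_class_eq_iff
        carrier_presented_group)
  then show ?case
    using Cons x by (cases b) (simp_all add: presented_class_mult)
qed

text \<open>Von Dyck's theorem.\<close>

lemma (in group) presented_group_hom: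
  assumes f: "range f \<subseteq> carrier G"
    and R: "\<And>u v. (u, v) \<in> R \<Longrightarrow> word_eval G f u = word_eval G f v"
  obtains h where "h \<in> hom (presented_group R) G"
    and "\<And>u. h (presented_class R u) = word_eval G f u"
proof
  \<comment> \<open>The representative is arbitrary; by \<open>word_eval_presentation_eq\<close> the
    value does not depend on it.\<close>
  define h where "h U = word_eval G f (SOME u. u \<in> U)" for U
  show h: "h (presented_class R u) = word_eval G f u" for u
  proof -
    have "(SOME v. v \<in> presented_class R u) \<in> presented_class R u"
      by (rule someI[of _ u]) (simp add: presented_class_def presentation_eq.refl)
    then have "presentation_eq R u (SOME v. v \<in> presented_class R u)"
      by (simp add: presented_class_def)
    then show ?thesis
      unfolding h_def using word_eval_presentation_eq[OF f R] by metis
  qed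
  show "h \<in> hom (presented_group R) G"
    by (rule homI) (auto simp: carrier_presented_group h presented_class_mult
        word_eval_append[OF f] f)
qed

subsection \<open>Baumslag--Solitar groups\<close>

text \<open>The relation set inside \<open>baumslag_solitar\<close>, named so that it can be folded
  into a single constant.\<close>

definition bs_relators :: "nat \<Rightarrow> nat \<Rightarrow> (bs_generator gword \<times> bs_generator gword) set" where
  "bs_relators k m =
     {([(t_gen, True)] @ replicate k (a_gen, True) @ [(t_gen, False)],
       replicate m (a_gen, True))}"

context group
begin

text \<open>Conjugation by \<open>t\<close> is an endomorphism that sends \<open>a\<close> to its
  \<open>m\<close>-th power; this handles negative exponents as well.\<close>

lemma conj_pow:
  assumes a: "a \<in> carrier G" and t: "t \<in> carrier G" and rel: "t \<otimes> a \<otimes> inv t = a [^] (m::nat)"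
  shows "t \<otimes> a [^] (b::int) = a [^] (int m * b) \<otimes> t"
proof -
  have "group_hom G G (\<lambda>x. t \<otimes> x \<otimes> inv t)"
    using t by (intro group_hom.intro group_hom_axioms.intro homI is_group)
      (auto simp: m_assoc inv_solve_left)
  then have "t \<otimes> a [^] b \<otimes> inv t = (t \<otimes> a \<otimes> inv t) [^] b"
    using a by (rule group_hom.hom_int_pow)
  also have "\<dots> = a [^] (int m * b)"
    using a by (simp add: rel int_pow_int[symmetric] int_pow_pow)
  finally show ?thesis
    using a t by (metis int_pow_closed inv_solve_right' m_closed)
qed

lemma pow_conj_pow:
  assumes a: "a \<in> carrier G" and t: "t \<in> carrier G" and rel: "t \<otimes> a \<otimes> inv t = a [^] (m::nat)"
  shows "t [^] (p::nat) \<otimes> a [^] (b::int) = a [^] (int (m ^ p) * b) \<otimes> t [^] p"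
proof (induction p arbitrary: b)
  case 0
  show ?case using a by simp
next
  case (Suc p)
  have "t [^] Suc p \<otimes> a [^] b = t [^] p \<otimes> (t \<otimes> a [^] b)"
    using a t by (simp add: m_assoc)
  also have "\<dots> = (t [^] p \<otimes> a [^] (int m * b)) \<otimes> t"
    using a t by (simp add: conj_pow[OF a t rel] m_assoc)
  also have "\<dots> = a [^] (int (m ^ Suc p) * b) \<otimes> t [^] Suc p"
    using a t by (simp add: Suc m_assoc mult_ac)
  finally show ?case .
qed

text \<open>Powers of \<open>a\<close> travel to the right past inverse powers of \<open>t\<close>,
  because in this direction the exponent is multiplied by \<open>m ^ p\<close> rather than
  divided.\<close>

lemma inv_pow_conj_pow:
  assumes a: "a \<in> carrier G" and t: "t \<in> carrier G" and rel: "t \<otimes> a \<otimes> inv t = a [^] (m::nat)"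
  shows "a [^] (b::int) \<otimes> inv (t [^] (p::nat)) = inv (t [^] p) \<otimes> a [^] (int (m ^ p) * b)"
proof -
  have "t [^] p \<otimes> a [^] b \<otimes> inv (t [^] p) = a [^] (int (m ^ p) * b)"
    using a t by (simp add: pow_conj_pow[OF a t rel] m_assoc)
  then show ?thesis
    using a t by (simp add: inv_solve_left m_assoc)
qed

text \<open>Letters are prepended one at a time. A letter \<open>a\<close> or its inverse passes the
  left power of \<open>t\<close> and changes \<open>b\<close> by \<open>m ^ p\<close> or its
  negative; the inverse of \<open>t\<close> raises \<open>p\<close>; the letter \<open>t\<close>
  lowers \<open>p\<close>, or raises \<open>q\<close> if \<open>p = 0\<close>.\<close>

lemma bs_normal_form:
  assumes f: "range f \<subseteq> carrier G"
    and rel: "f t_gen \<otimes> f a_gen \<otimes> inv f t_gen = f a_gen [^] (m::nat)"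
  shows "\<exists>(p::nat) (b::int) (q::nat).
    word_eval G f u = inv (f t_gen [^] p) \<otimes> f a_gen [^] b \<otimes> f t_gen [^] q"
proof (induction u)
  case Nil
  show ?case by (intro exI[of _ 0]) simp
next
  case (Cons x u)
  define a t where "a = f a_gen" and "t = f t_gen"
  have a: "a \<in> carrier G" and t: "t \<in> carrier G"
    using f by (auto simp: a_def t_def)
  note rel = rel[folded a_def t_def]
  obtain p q :: nat and b :: int
    where u: "word_eval G f u = inv (t [^] p) \<otimes> a [^] b \<otimes> t [^] q"
    using Cons unfolding a_def t_def by blast
  obtain g s where x: "x = (g, s)" by (cases x)
  consider (t) "g = t_gen" "s" | (t_inv) "g = t_gen" "\<not> s" | (a) "g = a_gen"
    by (cases g) auto
  then have "\<exists>(p::nat) (b::int) (q::nat).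
    word_eval G f (x # u) = inv (t [^] p) \<otimes> a [^] b \<otimes> t [^] q"
  proof cases
    case t
    show ?thesis
    proof (cases p)
      \<comment> \<open>No inverse of \<open>t\<close> is available for cancellation, so the new
        \<open>t\<close> moves past the power of \<open>a\<close> and joins the power on the
        right.\<close>
      case 0
      have "t \<otimes> (a [^] b \<otimes> t [^] q) = a [^] (int m * b) \<otimes> t [^] Suc q"
      proof -
        have "t \<otimes> (a [^] b \<otimes> t [^] q) = t \<otimes> a [^] b \<otimes> t [^] q"
          using a \<open>t \<in> carrier G\<close> by (simp add: m_assoc)
        also have "\<dots> = a [^] (int m * b) \<otimes> (t \<otimes> t [^] q)"
          using a \<open>t \<in> carrier G\<close> by (simp add: conj_pow[OF a \<open>t \<in> carrier G\<close> rel] m_assoc)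
        finally show ?thesis
          using \<open>t \<in> carrier G\<close> by (simp add: nat_pow_Suc2[symmetric] del: nat_pow_Suc)
      qed
      then show ?thesis
        using a \<open>t \<in> carrier G\<close> t x u 0
        by (intro exI[of _ 0] exI[of _ "int m * b"] exI[of _ "Suc q"]) (simp add: t_def[symmetric])
    next
      case (Suc k)
      have "t \<otimes> inv (t [^] Suc k) = inv (t [^] k)"
        using \<open>t \<in> carrier G\<close> by (simp add: inv_mult_group m_assoc[symmetric])
      then have "t \<otimes> (inv (t [^] Suc k) \<otimes> a [^] b \<otimes> t [^] q) = inv (t [^] k) \<otimes> a [^] b \<otimes> t [^] q"
        using a \<open>t \<in> carrier G\<close> by (simp add: m_assoc[symmetric] del: nat_pow_Suc)
      then show ?thesis
        using t x u Suc
        by (intro exI[of _ k] exI[of _ b] exI[of _ q]) (simp add: t_def[symmetric] del: nat_pow_Suc)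
    qed
  next
    case t_inv
    have "inv t \<otimes> inv (t [^] p) = inv (t [^] Suc p)"
      using t by (simp add: inv_mult_group)
    then have "inv t \<otimes> (inv (t [^] p) \<otimes> a [^] b \<otimes> t [^] q)
        = inv (t [^] Suc p) \<otimes> a [^] b \<otimes> t [^] q"
      using a t by (simp add: m_assoc[symmetric] del: nat_pow_Suc)
    then show ?thesis
      using t_inv x u
      by (intro exI[of _ "Suc p"] exI[of _ b] exI[of _ q]) (simp add: t_def[symmetric] del: nat_pow_Suc)
  next
    case g: a
    \<comment> \<open>With the sign as an exponent, \<open>a\<close> and its inverse form one
      case.\<close>
    define e :: int where "e = (if s then 1 else -1)"
    have "(if s then a else inv a) = a [^] e"
      using a by (simp add: e_def int_pow_neg)
    then have "word_eval G f (x # u) = a [^] e \<otimes> (inv (t [^] p) \<otimes> a [^] b \<otimes> t [^] q)"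
      using g x u by (simp add: a_def[symmetric] cong: if_cong split del: if_split)
    also have "\<dots> = a [^] e \<otimes> inv (t [^] p) \<otimes> a [^] b \<otimes> t [^] q"
      using a t by (simp add: m_assoc)
    also have "\<dots> = inv (t [^] p) \<otimes> a [^] (int (m ^ p) * e + b) \<otimes> t [^] q"
      using a t by (simp add: inv_pow_conj_pow[OF a t rel] int_pow_mult m_assoc)
    finally show ?thesis by blast
  qed
  then show ?case unfolding a_def t_def .
qed

lemma word_eval_conj_word:
  assumes f: "range f \<subseteq> carrier G"
  shows "word_eval G f ([(t, True)] @ replicate k (a, True) @ [(t, False)])
    = f t \<otimes> f a [^] k \<otimes> inv f t"
proof -
  have "f t \<in> carrier G" "f a \<in> carrier G"
    using f by auto
  then show ?thesis
    by (simp add: word_eval_append[OF f] word_eval_replicate[OF f] m_assoc)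
qed

text \<open>Von Dyck's theorem gives a surjection from the presented group. It is injective because
  \<open>free\<close> kills every normal form with trivial image.\<close>

proposition baumslag_solitar_iso_generated:
  assumes f: "range f \<subseteq> carrier G"
    and rel: "f t_gen \<otimes> f a_gen \<otimes> inv f t_gen = f a_gen [^] m"
    and free: "\<And>p q b. f a_gen [^] (b::int) \<otimes> f t_gen [^] (q::nat) = f t_gen [^] (p::nat)
      \<Longrightarrow> b = 0 \<and> p = q"
  shows "subgroup_generated G (range f) \<cong> baumslag_solitar 1 m"
proof -
  define R where "R = bs_relators 1 m"
  let ?P = "presented_group R" and ?cl = "presented_class R"
  let ?c = "\<lambda>g. ?cl [(g, True)]"
  interpret P: group ?P by (rule group_presented_group)
  have c: "range ?c \<subseteq> carrier ?P"
    by (auto simp: carrier_presented_group)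
  then have carr: "?c g \<in> carrier ?P" for g
    by auto
  have "word_eval ?P ?c ([(t_gen, True)] @ replicate 1 (a_gen, True) @ [(t_gen, False)])
      = word_eval ?P ?c (replicate m (a_gen, True))"
    unfolding word_eval_presented_group presented_class_eq_iff
    by (rule presentation_eq.relation) (simp add: R_def bs_relators_def)
  \<comment> \<open>The relation between words, read through evaluation, becomes the equation that
    \<open>bs_normal_form\<close> expects of the classes of the generators.\<close>
  from this[unfolded P.word_eval_conj_word[OF c] P.word_eval_replicate[OF c]]
  have P_rel: "?c t_gen \<otimes>\<^bsub>?P\<^esub> ?c a_gen \<otimes>\<^bsub>?P\<^esub> inv\<^bsub>?P\<^esub> ?c t_gen = ?c a_gen [^]\<^bsub>?P\<^esub> m"
    using carr by simp
  have fc: "f g \<in> carrier G" for g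
    using f by auto
  then have "word_eval G f u = word_eval G f v" if "(u, v) \<in> R" for u v
    using that word_eval_conj_word[OF f, of t_gen 1 a_gen] word_eval_replicate[OF f, of m a_gen] rel
    by (simp add: R_def bs_relators_def)
  then obtain h where h: "h \<in> hom ?P G" and h_cl: "\<And>u. h (?cl u) = word_eval G f u"
    using presented_group_hom[OF f] by metis
  interpret h: group_hom ?P G h
    using h by unfold_locales
  have h_c: "h (?c g) = f g" for g
    using fc by (simp add: h_cl)
  have "inj_on h (carrier ?P)"
    unfolding h.inj_on_one_iff
  proof (intro allI impI)
    fix U assume U: "U \<in> carrier ?P" "h U = \<one>"
    then obtain u where u: "U = word_eval ?P ?c u"
      by (auto simp: carrier_presented_group word_eval_presented_group)
    then obtain p q :: nat and b :: int
      where nf: "U = inv\<^bsub>?P\<^esub> (?c t_gen [^]\<^bsub>?P\<^esub> p) \<otimes>\<^bsub>?P\<^esub> ?c a_gen [^]\<^bsub>?P\<^esub> b \<otimes>\<^bsub>?P\<^esub> ?c t_gen [^]\<^bsub>?P\<^esub> q"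
      using P.bs_normal_form[OF c P_rel] by blast
    \<comment> \<open>This is the image under \<open>h\<close> of the normal form; moving the
      inverse power to the other side yields the premise of \<open>free\<close>.\<close>
    have "\<one> = inv (f t_gen [^] p) \<otimes> f a_gen [^] b \<otimes> f t_gen [^] q"
      using carr U(2) unfolding nf
      by (simp add: h.hom_nat_pow h.hom_int_pow h_c)
    then have "f a_gen [^] b \<otimes> f t_gen [^] q = f t_gen [^] p"
      using fc by (simp add: m_assoc inv_solve_left)
    then have "b = 0" "p = q"
      using free by blast+
    then show "U = \<one>\<^bsub>?P\<^esub>"
      using carr unfolding nf by simp
  qed
  moreover have "h ` carrier ?P = carrier (subgroup_generated G (range f))"
    using f by (simp add: carrier_presented_group image_image h_cl carrier_subgroup_generated
        Int_absorb1 generate_range_eq_word_eval)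
  ultimately have "h \<in> iso ?P (subgroup_generated G (range f))"
    using h unfolding iso_def bij_betw_def hom_def by auto
  then show ?thesis
    unfolding baumslag_solitar_def bs_relators_def[symmetric] R_def[symmetric] using P.iso_sym is_isoI by blast
qed

end

section \<open>Groups of tree automorphisms\<close>

lemma subgroup_tree_automorphisms: "subgroup (tree_automorphisms X) (BijGroup (lists X))"
proof -
  interpret group "BijGroup (lists X)" by (rule group_BijGroup)
  have closed: "f u \<in> lists X" if "f \<in> Bij (lists X)" "u \<in> lists X" for f u
    using Bij_imp_funcset[OF that(1)] that(2) by (rule funcset_mem)
  show ?thesis
  proof
    show "tree_automorphisms X \<subseteq> carrier (BijGroup (lists X))"
      by (auto simp: tree_automorphisms_def BijGroup_def)
    show "\<one>\<^bsub>BijGroup (lists X)\<^esub> \<in> tree_automorphisms X"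
      by (simp add: tree_automorphisms_def BijGroup_def id_Bij)
  next
    fix f g assume f: "f \<in> tree_automorphisms X" and g: "g \<in> tree_automorphisms X"
    then have "f \<in> Bij (lists X)" and gB: "g \<in> Bij (lists X)"
      by (auto simp: tree_automorphisms_def)
    then have "f \<otimes>\<^bsub>BijGroup (lists X)\<^esub> g = compose (lists X) f g"
      by (simp add: BijGroup_def)
    then show "f \<otimes>\<^bsub>BijGroup (lists X)\<^esub> g \<in> tree_automorphisms X"
      using f g closed[OF gB]
      by (auto simp: tree_automorphisms_def compose_Bij compose_eq)
  next
    fix f assume f: "f \<in> tree_automorphisms X"
    then have fB: "f \<in> Bij (lists X)"
      by (auto simp: tree_automorphisms_def)
    let ?g = "inv_into (lists X) f"
    have g: "?g u \<in> lists X" "f (?g u) = u" if "u \<in> lists X" for u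
      using fB that by (auto simp: Bij_inv_into_mem Bij_def bij_betw_def f_inv_into_f)
    have "?g [] = []"
      using f fB by (intro inv_into_f_eq) (auto simp: tree_automorphisms_def Bij_def bij_betw_def)
    moreover have "(\<exists>x. v = u @ [x]) \<longleftrightarrow> (\<exists>y. ?g v = ?g u @ [y])"
      if uv: "u \<in> lists X" "v \<in> lists X" for u v
    proof -
      \<comment> \<open>The edge condition for \<open>f\<close> is an equivalence, so applied at the
        preimages of \<open>u\<close> and \<open>v\<close> it is the edge condition for the
        inverse.\<close>
      have "(\<exists>y. ?g v = ?g u @ [y]) \<longleftrightarrow> (\<exists>x. f (?g v) = f (?g u) @ [x])"
        using f g(1)[OF uv(1)] g(1)[OF uv(2)] by (simp add: tree_automorphisms_def)
      then show ?thesis using g(2) uv by simp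
    qed
    moreover have "restrict ?g (lists X) \<in> Bij (lists X)"
      using fB by (rule restrict_inv_into_Bij)
    ultimately show "inv\<^bsub>BijGroup (lists X)\<^esub> f \<in> tree_automorphisms X"
      using fB by (simp add: inv_BijGroup tree_automorphisms_def)
  qed
qed

lemma group_tree_automorphism_group: "group (tree_automorphism_group X)"
  unfolding tree_automorphism_group_def
  by (rule subgroup.subgroup_is_group[OF subgroup_tree_automorphisms group_BijGroup])

lemma tree_automorphism_group_carrier_Bij:
  "f \<in> carrier (tree_automorphism_group X) \<Longrightarrow> f \<in> Bij (lists X)"
  by (simp add: tree_automorphism_group_def tree_automorphisms_def)

lemma one_tree_automorphism_group:
  "\<one>\<^bsub>tree_automorphism_group X\<^esub> = (\<lambda>w\<in>lists X. w)"
  by (simp add: tree_automorphism_group_def BijGroup_def)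

lemma mult_tree_automorphism_group:
  assumes "f \<in> carrier (tree_automorphism_group X)" "g \<in> carrier (tree_automorphism_group X)"
  shows "f \<otimes>\<^bsub>tree_automorphism_group X\<^esub> g = compose (lists X) f g"
  using assms[THEN tree_automorphism_group_carrier_Bij]
  by (simp add: tree_automorphism_group_def BijGroup_def)

text \<open>Each set lies in the subgroup generated by the other. The inclusions in the carrier
  ensure that \<open>subgroup_generated\<close> discards no generator.\<close>

lemma (in group) subgroup_generated_cong:
  assumes S: "S \<subseteq> carrier G" and T: "T \<subseteq> carrier G"
    and "S \<subseteq> generate G T" and "T \<subseteq> generate G S"
  shows "subgroup_generated G S = subgroup_generated G T"
proof -
  have "generate G S = generate G T"
    using assms by (intro equalityI generate_subgroup_incl generate_is_subgroup)
  then show ?thesis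
    using S T by (simp add: subgroup_generated_def Int_absorb1)
qed

section \<open>Words as integers modulo powers of the base\<close>

abbreviation word_value :: "nat \<Rightarrow> nat list \<Rightarrow> int" where
  "word_value n \<equiv> horner_sum int (int n)"

text \<open>Uniqueness of base \<open>n\<close> digits: the value modulo \<open>n\<close> is the
  first digit, and once it is subtracted, dividing by \<open>n\<close> lowers the modulus by one
  power.\<close>

lemma word_value_inj:
  assumes "length v = length w" "v \<in> lists {..<n}" "w \<in> lists {..<n}"
    and "[word_value n v = word_value n w] (mod int n ^ length w)"
  shows "v = w"
  using assms
proof (induction v w rule: list_induct2)
  case (Cons x v y w)
  let ?V = "word_value n v" and ?W = "word_value n w"
  have cong: "[int x + int n * ?V = int y + int n * ?W] (mod int n * int n ^ length w)"
    using Cons.prems by simp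
  then have "[int x + int n * ?V = int y + int n * ?W] (mod int n)"
    by (rule cong_modulus_mult)
  then have "[int x = int y] (mod int n)"
    by (simp add: cong_def)
  moreover have "x < n" "y < n"
    using Cons.prems by auto
  ultimately have xy: "x = y"
    by (simp add: cong_def)
  with cong have "[int n * ?V = int n * ?W] (mod int n * int n ^ length w)"
    by (simp add: cong_add_lcancel)
  then have "[?V = ?W] (mod int n ^ length w)"
    using \<open>x < n\<close> by (simp add: cong_iff_dvd_diff right_diff_distrib[symmetric])
  with Cons xy show ?case by simp
qed simp

lemma word_value_replicate_zero [simp]: "word_value n (replicate l 0) = 0"
  by (induction l) auto

lemma eq_if_cong_all_powers:
  fixes a b :: int
  assumes "n \<ge> 2" and "\<And>l. [a = b] (mod int n ^ Suc l)"
  shows "a = b"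
proof (rule ccontr)
  assume "a \<noteq> b"
  have dvd: "int n ^ Suc l dvd a - b" for l
    using assms(2) by (simp add: cong_iff_dvd_diff)
  \<comment> \<open>Already \<open>2 ^ Suc l\<close> exceeds the difference, while
    \<open>int n ^ Suc l\<close> divides it.\<close>
  define l where "l = nat \<bar>a - b\<bar>"
  have "\<bar>a - b\<bar> < 2 ^ Suc l"
    using of_nat_less_iff[of l "2 ^ l", where 'a = int] less_exp[of l] by (simp add: l_def)
  also have "\<dots> \<le> int n ^ Suc l"
    using assms(1) by (intro power_mono) auto
  finally show False
    using dvd_imp_le_int[OF _ dvd[of l]] \<open>a \<noteq> b\<close> by simp
qed

text \<open>The map \<open>z \<mapsto> c z + b\<close> on the \<open>n\<close>-adic integers,
  recorded by its reductions on the levels of the tree, so that no limit object is needed.\<close>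

definition acts_affinely :: "nat \<Rightarrow> int \<Rightarrow> int \<Rightarrow> (nat list \<Rightarrow> nat list) \<Rightarrow> bool" where
  "acts_affinely n c b f \<longleftrightarrow>
     (\<forall>w\<in>lists {..<n}. f w \<in> lists {..<n} \<and> length (f w) = length w \<and>
        [word_value n (f w) = c * word_value n w + b] (mod int n ^ length w))"

lemma acts_affinelyD:
  assumes "acts_affinely n c b f" "w \<in> lists {..<n}"
  shows "f w \<in> lists {..<n}" "length (f w) = length w"
    "[word_value n (f w) = c * word_value n w + b] (mod int n ^ length w)"
  using assms by (auto simp: acts_affinely_def)

text \<open>The coefficients fix the value of every image modulo the power of \<open>n\<close> given
  by its length, hence its digits. Identities between automorphisms thus reduce to comparing two
  integers.\<close>

lemma acts_affinely_eq:
  assumes "f \<in> carrier (tree_automorphism_group {..<n})" "acts_affinely n c b f"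
    and "g \<in> carrier (tree_automorphism_group {..<n})" "acts_affinely n c b g"
  shows "f = g"
proof (rule extensionalityI)
  show "f \<in> extensional (lists {..<n})" "g \<in> extensional (lists {..<n})"
    using assms(1,3)[THEN tree_automorphism_group_carrier_Bij] by (auto simp: Bij_def)
next
  fix w assume w: "w \<in> lists {..<n}"
  note F = acts_affinelyD[OF assms(2) w] and G = acts_affinelyD[OF assms(4) w]
  show "f w = g w"
    using F G by (intro word_value_inj[of _ _ n]) (auto intro: cong_trans cong_sym)
qed

text \<open>The words \<open>0...0\<close> and \<open>10...0\<close> have values 0 and 1 at every
  positive length, so \<open>b\<close> and \<open>c + b\<close> are determined modulo all powers of
  \<open>n\<close>.\<close>

lemma acts_affinely_unique:
  assumes "n \<ge> 2" "acts_affinely n c b f" "acts_affinely n c' b' f"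
  shows "c = c'" "b = b'"
proof -
  have cong: "[c * word_value n w + b = c' * word_value n w + b'] (mod int n ^ length w)"
    if "w \<in> lists {..<n}" for w
    using acts_affinelyD(3)[OF assms(2) that] acts_affinelyD(3)[OF assms(3) that]
    by (auto intro: cong_trans cong_sym)
  have "[b = b'] (mod int n ^ Suc l)" for l
    using cong[of "replicate (Suc l) 0"] assms(1) by (simp add: in_lists_conv_set)
  then show b: "b = b'"
    using assms(1) eq_if_cong_all_powers by blast
  have "[c + b = c' + b'] (mod int n ^ Suc l)" for l
    using cong[of "1 # replicate l 0"] assms(1) by (simp add: in_lists_conv_set)
  then have "c + b = c' + b'"
    using assms(1) eq_if_cong_all_powers by blast
  with b show "c = c'" by simp
qed

lemma acts_affinely_one: "acts_affinely n 1 0 \<one>\<^bsub>tree_automorphism_group {..<n}\<^esub>"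
  by (simp add: acts_affinely_def one_tree_automorphism_group)

text \<open>Products compose with the right factor acting first:
  \<open>c (c' z + b') + b\<close>.\<close>

lemma acts_affinely_mult:
  assumes "f \<in> carrier (tree_automorphism_group {..<n})" "acts_affinely n c b f"
    and "g \<in> carrier (tree_automorphism_group {..<n})" "acts_affinely n c' b' g"
  shows "acts_affinely n (c * c') (c * b' + b) (f \<otimes>\<^bsub>tree_automorphism_group {..<n}\<^esub> g)"
  unfolding acts_affinely_def
proof
  fix w assume w: "w \<in> lists {..<n}"
  note G = acts_affinelyD[OF assms(4) w]
  note F = acts_affinelyD[OF assms(2) G(1)]
  have "[c * word_value n (g w) + b = c * (c' * word_value n w + b') + b] (mod int n ^ length w)"
    using G(3) by (intro cong_add cong_mult cong_refl)
  with F(3) have "[word_value n (f (g w)) = c * c' * word_value n w + (c * b' + b)]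
      (mod int n ^ length w)"
    using G(2) by (auto simp: algebra_simps intro: cong_trans)
  then show "(f \<otimes>\<^bsub>tree_automorphism_group {..<n}\<^esub> g) w \<in> lists {..<n} \<and>
      length ((f \<otimes>\<^bsub>tree_automorphism_group {..<n}\<^esub> g) w) = length w \<and>
      [word_value n ((f \<otimes>\<^bsub>tree_automorphism_group {..<n}\<^esub> g) w)
        = c * c' * word_value n w + (c * b' + b)] (mod int n ^ length w)"
    using F G w by (simp add: mult_tree_automorphism_group[OF assms(1,3)] compose_eq)
qed

text \<open>
  Division on the right avoids inverting \<open>c\<close>, which is only possible modulo each single power
  of \<open>n\<close>.
\<close>

lemma acts_affinely_right_quotient:
  assumes g: "g \<in> carrier (tree_automorphism_group {..<n})"
    and f: "f \<in> carrier (tree_automorphism_group {..<n})" "acts_affinely n c b f"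
    and h: "acts_affinely n c (b + e) (g \<otimes>\<^bsub>tree_automorphism_group {..<n}\<^esub> f)"
  shows "acts_affinely n 1 e g"
  unfolding acts_affinely_def
proof
  fix w assume "w \<in> lists {..<n}"
  \<comment> \<open>Since \<open>f\<close> is onto, the value of \<open>g\<close> at
    \<open>w = f v\<close> can be read off from the product at \<open>v\<close>.\<close>
  then have "w \<in> f ` lists {..<n}"
    using tree_automorphism_group_carrier_Bij[OF f(1)] by (simp add: Bij_def bij_betw_def)
  then obtain v where v: "v \<in> lists {..<n}" and w: "w = f v"
    by blast
  have gf: "(g \<otimes>\<^bsub>tree_automorphism_group {..<n}\<^esub> f) v = g w"
    using v w by (simp add: mult_tree_automorphism_group[OF g f(1)] compose_eq)
  note F = acts_affinelyD[OF f(2) v] and H = acts_affinelyD[OF h v]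
  have "[c * word_value n v + b + e = word_value n w + e] (mod int n ^ length v)"
    using F(3) w by (intro cong_add cong_refl) (simp add: cong_sym)
  with H(3) have "[word_value n (g w) = word_value n w + e] (mod int n ^ length v)"
    unfolding gf by (auto simp: add.assoc intro: cong_trans)
  then show "g w \<in> lists {..<n} \<and> length (g w) = length w \<and>
      [word_value n (g w) = 1 * word_value n w + e] (mod int n ^ length w)"
    using F(2) H gf w by simp
qed

lemma acts_affinely_nat_pow:
  assumes f: "f \<in> carrier (tree_automorphism_group {..<n})" "acts_affinely n c 0 f"
  shows "acts_affinely n (c ^ k) 0 (f [^]\<^bsub>tree_automorphism_group {..<n}\<^esub> (k::nat))"
proof (induction k)
  case 0
  show ?case using acts_affinely_one by simp
next
  case (Suc k)
  interpret group "tree_automorphism_group {..<n}" by (rule group_tree_automorphism_group)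
  show ?case
    using acts_affinely_mult[OF _ Suc f] f(1) by (simp add: mult.commute)
qed

lemma acts_affinely_int_pow:
  assumes f: "f \<in> carrier (tree_automorphism_group {..<n})" "acts_affinely n 1 1 f"
  shows "acts_affinely n 1 b (f [^]\<^bsub>tree_automorphism_group {..<n}\<^esub> (b::int))"
proof -
  interpret group "tree_automorphism_group {..<n}" by (rule group_tree_automorphism_group)
  have nat_pow: "acts_affinely n 1 (int k) (f [^]\<^bsub>tree_automorphism_group {..<n}\<^esub> k)" for k :: nat
  proof (induction k)
    case 0
    show ?case using acts_affinely_one by simp
  next
    case (Suc k)
    show ?case using acts_affinely_mult[OF _ Suc f] f(1) by simp
  qed
  show ?thesis
  proof (cases b)
    case (nonneg k)
    then show ?thesis using nat_pow by (simp add: int_pow_int)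
  next
    case (neg k)
    \<comment> \<open>The case \<open>neg k\<close> means \<open>b = - (k + 1)\<close>. The inverse
      times the power is the identity, with coefficients 1 and 0, so the right quotient has
      translation \<open>0 - (k + 1)\<close>.\<close>
    have "acts_affinely n 1 (- int (Suc k))
        (inv\<^bsub>tree_automorphism_group {..<n}\<^esub> (f [^]\<^bsub>tree_automorphism_group {..<n}\<^esub> Suc k))"
      using f(1) nat_pow[of "Suc k"] acts_affinely_one
      by (intro acts_affinely_right_quotient[where f = "f [^]\<^bsub>tree_automorphism_group {..<n}\<^esub> Suc k"])
        (auto simp del: nat_pow_Suc)
    then show ?thesis by (simp only: neg int_pow_neg_int[OF f(1)])
  qed
qed

section \<open>The automata S and D\<close>

lemma S_automaton_sel [simp]:
  "states (S_automaton m n) = {..<m}" "alphabet (S_automaton m n) = {..<n}"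
  by (simp_all add: S_automaton_def)

lemma D_automaton_sel [simp]:
  "states (D_automaton m n m' n') = {..<m}" "alphabet (D_automaton m n m' n') = {..<n}"
  by (simp_all add: D_automaton_def)

text \<open>This is schoolbook multiplication by \<open>m\<close>: the state is the carry, the
  remainder modulo \<open>n\<close> is the output digit and the quotient is the next carry.\<close>

lemma run_S_word_value:
  assumes pos: "m > 0" "n > 0" and cop: "coprime m n" and "i < m" "w \<in> lists {..<n}"
  shows "[word_value n (run (S_automaton m n) i w) = int m * word_value n w + int i]
    (mod int n ^ length w)"
  using assms(4,5)
proof (induction w arbitrary: i)
  case (Cons j w)
  let ?S = "S_automaton m n" and ?k = "(m * j + i) div n" and ?x = "(m * j + i) mod n"
  let ?V = "word_value n w" and ?V' = "word_value n (run (S_automaton m n) ((m * j + i) div n) w)"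
  have j: "j < n" and w: "w \<in> lists {..<n}"
    using Cons.prems by auto
  have S: "rewriting ?S (i, j) = ?x" "transition ?S (i, j) = ?k"
    using Cons.prems j by (simp_all add: S_automaton_def)
  then have "?k < m"
    using invertible_transition_closed[OF invertible_S_automaton[OF pos cop], of i j] Cons.prems j
    by simp
  then have "[?V' = int m * ?V + int ?k] (mod int n ^ length w)"
    using Cons.IH w by blast
  \<comment> \<open>Multiplying by \<open>n\<close> shifts the tail by one digit and raises the
    modulus by one power.\<close>
  then have "[int n * ?V' = int n * (int m * ?V + int ?k)] (mod int n * int n ^ length w)"
    by (simp add: cong_iff_dvd_diff right_diff_distrib[symmetric])
  then have "[int ?x + int n * ?V' = int ?x + int n * (int m * ?V + int ?k)]
      (mod int n * int n ^ length w)"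
    by (intro cong_add cong_refl)
  moreover have "int m * int j + int i = int ?x + int n * int ?k"
    by (metis mod_mult_div_eq of_nat_add of_nat_mult)
  then have "int ?x + int n * (int m * ?V + int ?k) = int m * (int j + int n * ?V) + int i"
    by (simp add: distrib_left mult.left_commute)
  ultimately show ?case
    by (simp add: S)
qed simp

section \<open>The automaton \<open>D\<close>: inverse of \<open>S\<close>, dual,
  bi-invertibility\<close>

locale D_parameters =
  fixes m n :: nat and m' n' :: int
  assumes m_pos: "m > 0" and n_pos: "n > 0" and coprime_m_n: "coprime m n"
    and m': "[int m * m' = 1] (mod int n)"
    and n': "[int n * n' = 1] (mod int m)"
begin

abbreviation "S \<equiv> S_automaton m n"
abbreviation "D \<equiv> D_automaton m n m' n'"

lemmas invertible_S = invertible_S_automaton[OF m_pos n_pos coprime_m_n]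

lemma S_rewriting_bij: "i < m \<Longrightarrow> bij_betw (\<lambda>j. rewriting S (i, j)) {..<n} {..<n}"
  using invertible_rewriting_bij[OF invertible_S, of i] by simp

lemma S_closed:
  assumes "i < m" "j < n"
  shows "rewriting S (i, j) < n" "transition S (i, j) < m"
  using assms invertible_rewriting_closed[OF invertible_S, of i j]
    invertible_transition_closed[OF invertible_S, of i j]
  by (simp_all add: S_automaton_def)

text \<open>The division identity gives \<open>x - i = m j - n k\<close>. Multiplying by
  \<open>m'\<close> modulo \<open>n\<close> recovers the letter \<open>j\<close>; negating and
  multiplying by \<open>n'\<close> modulo \<open>m\<close> recovers the next state
  \<open>k\<close>.\<close>

lemma D_S:
  assumes i: "i < m" and j: "j < n"
  shows "rewriting D (i, rewriting S (i, j)) = j"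
    and "transition D (i, rewriting S (i, j)) = transition S (i, j)"
proof -
  define x k where "x = (m * j + i) mod n" and "k = (m * j + i) div n"
  have Sx: "rewriting S (i, j) = x" and Sk: "transition S (i, j) = k"
    using i j by (simp_all add: S_automaton_def x_def k_def)
  have x: "x < n" and k: "k < m"
    using S_closed[OF i j] Sx Sk by simp_all
  have "m * j + i = x + n * k"
    by (simp add: x_def k_def)
  then have "int (m * j + i) = int (x + n * k)"
    by (rule arg_cong)
  then have eq: "int x - int i = int m * int j - int n * int k"
    by simp
  have "[m' * (int x - int i) = (int m * m') * int j + int n * (- m' * int k)] (mod int n)"
    by (simp add: eq algebra_simps)
  also have "[(int m * m') * int j + int n * (- m' * int k) = 1 * int j + 0] (mod int n)"
    by (intro cong_add cong_mult m' cong_refl) (simp add: cong_def)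
  finally have "(m' * (int x - int i)) mod int n = int j"
    using j by (simp add: cong_def)
  then show "rewriting D (i, rewriting S (i, j)) = j"
    unfolding Sx using i x by (simp add: D_automaton_def)
  have "int i - int x = int n * int k - int m * int j"
    using eq by simp
  then have "[n' * (int i - int x) = (int n * n') * int k + int m * (- n' * int j)] (mod int m)"
    by (simp only:) (simp add: algebra_simps)
  also have "[(int n * n') * int k + int m * (- n' * int j) = 1 * int k + 0] (mod int m)"
    by (intro cong_add cong_mult n' cong_refl) (simp add: cong_def)
  finally have "(n' * (int i - int x)) mod int m = int k"
    using k by (simp add: cong_def)
  then show "transition D (i, rewriting S (i, j)) = transition S (i, j)"
    unfolding Sx Sk using i x by (simp add: D_automaton_def)
qed

text \<open>Every letter \<open>x\<close> is an output of \<open>S\<close> in state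
  \<open>i\<close>, so \<open>D_S\<close> describes \<open>D\<close> on all pairs.\<close>

lemma D_rewriting_inv_into:
  assumes "i < m" "x < n"
  shows "inv_into {..<n} (\<lambda>j. rewriting S (i, j)) x = rewriting D (i, x)"
    and "transition S (i, rewriting D (i, x)) = transition D (i, x)"
proof -
  have "x \<in> (\<lambda>j. rewriting S (i, j)) ` {..<n}"
    using S_rewriting_bij[OF assms(1)] assms(2) by (simp add: bij_betw_def)
  then obtain j where j: "j < n" "rewriting S (i, j) = x"
    by auto
  then show "inv_into {..<n} (\<lambda>j. rewriting S (i, j)) x = rewriting D (i, x)"
    using D_S(1)[OF assms(1) j(1)] S_rewriting_bij[OF assms(1)]
    by (intro inv_into_f_eq) (auto simp: bij_betw_def)
  show "transition S (i, rewriting D (i, x)) = transition D (i, x)"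
    using D_S[OF assms(1) j(1)] j(2) by simp
qed

lemma D_iso_inverse_S: "automaton_iso Bar (\<lambda>x. x) D (inverse_automaton S)"
  using D_rewriting_inv_into
  by (auto simp: automaton_iso_def inverse_automaton_def bij_betw_def inj_on_def Let_def)

lemma invertible_D: "invertible_automaton D"
proof -
  have "bij_betw (\<lambda>x. rewriting D (i, x)) {..<n} {..<n}" if "i < m" for i
    using bij_betw_inv_into[OF S_rewriting_bij[OF that]] D_rewriting_inv_into(1)[OF that]
    by (subst bij_betw_cong[where g = "inv_into {..<n} (\<lambda>j. rewriting S (i, j))"]) auto
  moreover have "is_automaton D"
    using m_pos n_pos by (auto simp: is_automaton_def D_automaton_def nat_less_iff)
  ultimately show ?thesis
    by (simp add: invertible_automaton_def)
qed

text \<open>Modular inverses are unique up to congruence, and the formulas see \<open>m'\<close>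
  only modulo \<open>n\<close> and \<open>n'\<close> only modulo \<open>m\<close>.\<close>

lemma D_automaton_unique:
  assumes "[int m * m'' = 1] (mod int n)" "[int n * n'' = 1] (mod int m)"
  shows "D_automaton m n m'' n'' = D"
proof -
  have "[m'' = m'] (mod int n)"
    using assms(1) m' coprime_m_n
    by (metis cong_mult_lcancel cong_sym cong_trans coprime_int_iff)
  moreover have "[n'' = n'] (mod int m)"
    using assms(2) n' coprime_m_n
    by (metis cong_mult_lcancel cong_sym cong_trans coprime_commute coprime_int_iff)
  ultimately have "(m'' * z) mod int n = (m' * z) mod int n" "(n'' * z) mod int m = (n' * z) mod int m"
    for z
    by (auto simp flip: cong_def intro: cong_scalar_right)
  then show ?thesis
    by (simp add: D_automaton_def)
qed

lemma swap_parameters: "D_parameters n m n' m'"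
  using m_pos n_pos coprime_m_n m' n' by unfold_locales (simp_all add: coprime_commute)

text \<open>Exchanging \<open>m\<close> with \<open>n\<close>, \<open>m'\<close> with
  \<open>n'\<close> and \<open>i\<close> with \<open>j\<close> interchanges the two formulas, so the
  automata agree without relabelling.\<close>

lemma dual_D: "dual_automaton D = D_automaton n m n' m'"
  by (auto simp: dual_automaton_def D_automaton_def fun_eq_iff restrict_def)

lemma bi_invertible_D: "bi_invertible D"
  using invertible_D D_parameters.invertible_D[OF swap_parameters]
  by (simp add: bi_invertible_def dual_D)

lemma run_D_run_S:
  assumes "i < m" "w \<in> lists {..<n}"
  shows "run D i (run S i w) = w"
  using assms(2,1) by (induction w arbitrary: i) (auto simp: D_S S_closed)

section \<open>The group generated by the states of \<open>D\<close>\<close>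

abbreviation "T \<equiv> tree_automorphism_group {..<n}"

lemma state_action_S_carrier: "i < m \<Longrightarrow> state_action S i \<in> carrier T"
  using state_action_in_carrier[OF invertible_S, of i] by simp

lemma state_action_D_carrier: "i < m \<Longrightarrow> state_action D i \<in> carrier T"
  using state_action_in_carrier[OF invertible_D, of i] by simp

lemma state_action_D:
  assumes "i < m"
  shows "state_action D i = inv\<^bsub>T\<^esub> state_action S i"
proof -
  interpret group T by (rule group_tree_automorphism_group)
  have "compose (lists {..<n}) (state_action D i) (state_action S i) = (\<lambda>w\<in>lists {..<n}. w)"
  proof
    fix w
    show "compose (lists {..<n}) (state_action D i) (state_action S i) w = (\<lambda>w\<in>lists {..<n}. w) w"
      using run_D_run_S[OF assms, of w] run_in_lists[OF invertible_S, of i w] assms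
      by (simp add: compose_def state_action_def)
  qed
  then have "state_action D i \<otimes>\<^bsub>T\<^esub> state_action S i = \<one>\<^bsub>T\<^esub>"
    using assms
    by (simp add: mult_tree_automorphism_group one_tree_automorphism_group state_action_S_carrier state_action_D_carrier)
  then show ?thesis
    using assms inv_equality state_action_S_carrier state_action_D_carrier by metis
qed

lemma state_action_S_affine: "i < m \<Longrightarrow> acts_affinely n (int m) (int i) (state_action S i)"
  using run_S_word_value[OF m_pos n_pos coprime_m_n, of i] run_in_lists[OF invertible_S, of i]
  by (simp add: acts_affinely_def state_action_def)

lemma automaton_group_D_iso:
  assumes m: "m \<ge> 2" and n: "n \<ge> 2"
  shows "automaton_group D \<cong> baumslag_solitar 1 m"
proof -
  interpret group T by (rule group_tree_automorphism_group)
  let ?s = "state_action S"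
  define t where "t = ?s 0"
  \<comment> \<open>Since \<open>a t\<close> is the state \<open>s_1\<close>, acting as
    \<open>m z + 1\<close>, and \<open>t\<close> acts as \<open>m z\<close>, the quotient
    \<open>a\<close> acts as \<open>z + 1\<close>.\<close>
  define a where "a = ?s 1 \<otimes>\<^bsub>T\<^esub> inv\<^bsub>T\<^esub> t"
  have t: "t \<in> carrier T" and s1: "?s 1 \<in> carrier T"
    using m state_action_S_carrier by (auto simp: t_def)
  then have a: "a \<in> carrier T" and at: "a \<otimes>\<^bsub>T\<^esub> t = ?s 1"
    by (simp_all add: a_def m_assoc)
  have t_aff: "acts_affinely n (int m) 0 t"
    using state_action_S_affine[of 0] m by (simp add: t_def)
  have a_aff: "acts_affinely n 1 1 a"
    using acts_affinely_right_quotient[OF a t t_aff] state_action_S_affine[of 1] m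
    by (simp add: at)
  have s: "?s i = a [^]\<^bsub>T\<^esub> (int i) \<otimes>\<^bsub>T\<^esub> t" if "i < m" for i
  proof (rule acts_affinely_eq)
    show "?s i \<in> carrier T" "acts_affinely n (int m) (int i) (?s i)"
      using that state_action_S_carrier state_action_S_affine by auto
    show "a [^]\<^bsub>T\<^esub> (int i) \<otimes>\<^bsub>T\<^esub> t \<in> carrier T"
      using a t by simp
    show "acts_affinely n (int m) (int i) (a [^]\<^bsub>T\<^esub> (int i) \<otimes>\<^bsub>T\<^esub> t)"
      using acts_affinely_mult[OF _ acts_affinely_int_pow[OF a a_aff, of "int i"] t t_aff] a by simp
  qed
  \<comment> \<open>Both sides act as \<open>m z + m\<close>.\<close>
  have "t \<otimes>\<^bsub>T\<^esub> a = a [^]\<^bsub>T\<^esub> (int m) \<otimes>\<^bsub>T\<^esub> t"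
  proof (rule acts_affinely_eq)
    show "acts_affinely n (int m) (int m) (t \<otimes>\<^bsub>T\<^esub> a)"
      using acts_affinely_mult[OF t t_aff a a_aff] by simp
    show "acts_affinely n (int m) (int m) (a [^]\<^bsub>T\<^esub> (int m) \<otimes>\<^bsub>T\<^esub> t)"
      using acts_affinely_mult[OF _ acts_affinely_int_pow[OF a a_aff, of "int m"] t t_aff] a by simp
  qed (use a t in simp_all)
  then have rel: "t \<otimes>\<^bsub>T\<^esub> a \<otimes>\<^bsub>T\<^esub> inv\<^bsub>T\<^esub> t = a [^]\<^bsub>T\<^esub> m"
    using a t by (simp add: int_pow_int inv_solve_right')
  have free: "b = 0 \<and> p = q"
    if eq: "a [^]\<^bsub>T\<^esub> b \<otimes>\<^bsub>T\<^esub> t [^]\<^bsub>T\<^esub> q = t [^]\<^bsub>T\<^esub> p" for p q :: nat and b :: int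
  proof -
    \<comment> \<open>The assumed equation gives the power of \<open>t\<close> a second affine
      description; uniqueness compares it with slope \<open>m ^ p\<close> and translation 0.\<close>
    have "acts_affinely n (int m ^ q) b (t [^]\<^bsub>T\<^esub> p)"
      using acts_affinely_mult[OF _ acts_affinely_int_pow[OF a a_aff, of b] _
          acts_affinely_nat_pow[OF t t_aff, of q]] a t
      by (simp add: eq)
    then have "int m ^ q = int m ^ p" "b = 0"
      using acts_affinely_unique[OF n] acts_affinely_nat_pow[OF t t_aff, of p] by blast+
    then show ?thesis
      using m by (simp flip: of_nat_power)
  qed
  define f where "f g = (case g of a_gen \<Rightarrow> a | t_gen \<Rightarrow> t)" for g
  have range_f: "range f = {a, t}"
    by (auto simp: f_def image_iff split: bs_generator.splits
        intro: exI[of _ a_gen] exI[of _ t_gen])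
  let ?Ds = "state_action D ` {..<m}"
  have Ds: "?Ds \<subseteq> carrier T"
    using state_action_D_carrier by auto
  \<comment> \<open>The states of \<open>D\<close> act as the inverses of those of \<open>S\<close>,
    so each generating set is expressed through the other by way of \<open>S\<close>.\<close>
  have "?Ds \<subseteq> generate T {a, t}"
  proof (rule image_subsetI)
    fix i assume "i \<in> {..<m}"
    then have i: "i < m" by simp
    have H: "subgroup (generate T {a, t}) T"
      using a t by (intro generate_is_subgroup) simp
    have "a \<in> generate T {a, t}" "t \<in> generate T {a, t}"
      by (auto intro: generate.incl)
    then have "?s i \<in> generate T {a, t}"
      using s[OF i] subgroup_int_pow_closed[OF H] subgroup.m_closed[OF H] by simp
    then show "state_action D i \<in> generate T {a, t}"
      using state_action_D[OF i] subgroup.m_inv_closed[OF H] by simp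
  qed
  moreover have "{a, t} \<subseteq> generate T ?Ds"
  proof -
    have H: "subgroup (generate T ?Ds) T"
      using Ds by (rule generate_is_subgroup)
    have "?s i \<in> generate T ?Ds" if "i < m" for i
    proof -
      have "inv\<^bsub>T\<^esub> state_action D i \<in> generate T ?Ds"
        using that by (intro generate.inv) simp
      then show ?thesis
        using that state_action_D state_action_S_carrier by simp
    qed
    then have "?s 1 \<in> generate T ?Ds" "t \<in> generate T ?Ds"
      using m by (auto simp: t_def)
    then show ?thesis
      using subgroup.m_closed[OF H] subgroup.m_inv_closed[OF H] by (simp add: a_def)
  qed
  ultimately have "subgroup_generated T ?Ds = subgroup_generated T (range f)"
    using Ds a t unfolding range_f by (intro subgroup_generated_cong) auto
  then have "automaton_group D = subgroup_generated T (range f)"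
    by (simp add: automaton_group_def)
  also have "\<dots> \<cong> baumslag_solitar 1 m"
    using a t rel free range_f by (intro baumslag_solitar_iso_generated) (auto simp: f_def)
  finally show ?thesis .
qed

end

theorem proposition5:
  fixes m n :: nat and m' n' :: int
  assumes "m \<ge> 2" and "n \<ge> 2" and "coprime m n"
    and "[int m * m' = 1] (mod int n)"
    and "[int n * n' = 1] (mod int m)"
  shows
    "(\<forall>m'' n''. [int m * m'' = 1] (mod int n) \<longrightarrow> [int n * n'' = 1] (mod int m) \<longrightarrow>
        D_automaton m n m'' n'' = D_automaton m n m' n') \<and>
     automaton_iso Bar (\<lambda>x. x) (D_automaton m n m' n') (inverse_automaton (S_automaton m n)) \<and>
     dual_automaton (D_automaton m n m' n') = D_automaton n m n' m' \<and>
     bi_invertible (D_automaton m n m' n') \<and>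
     automaton_group (D_automaton m n m' n') \<cong> baumslag_solitar 1 m"
proof -
  interpret D_parameters m n m' n'
    using assms by unfold_locales auto
  show ?thesis
    using D_automaton_unique D_iso_inverse_S dual_D bi_invertible_D
      automaton_group_D_iso[OF assms(1,2)] by blast
qed

end
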